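(* Let $\kappa\ge1$ be an integer, let $D\subseteq\mathbb{C}$ be an open or closed disc or an open or closed half-plane, and let $P(\lambda)\in\mathbb{C}^{n,n}[\lambda]$ be a matrix polynomial of degree at most $\kappa$. Then $P(\lambda)$ is hyperstable with respect to $D$ if and only if its polarization $(T_\kappa P)(z_1,\dots,z_\kappa)$ is hyperstable with respect to $D^\kappa$.
   Context: A multivariate matrix polynomial $R(z_1,\dots,z_\kappa)$ with coefficients in $\mathbb{C}^{n,n}$ is hyperstable with respect to $D^\kappa$ ($D\subseteq\mathbb{C}$ nonempty open or closed) if for every $x\in\mathbb{C}^n\setminus\{0\}$ there exists $y\in\mathbb{C}^n\setminus\{0\}$ such that $y^*R(\mu_1,\dots,\mu_\kappa)x\neq0$ for all $(\mu_1,\dots,\mu_\kappa)\in D^\kappa$; for $\kappa=1$ this defines hyperstability of a one-variable matrix polynomial with respect to $D$. Polarization: for $P(\lambda)=\lambda^dA_d+\dots+\lambda A_1+A_0$ of degree $d\le\kappa$, put $A_{d+1}=\dots=A_\kappa=0$ and define $$(T_\kappa P)(z_1,\dots,z_\kappa)=\sum_{j=0}^\kappa\binom{\kappa}{j}^{-1}s_j(z_1,\dots,z_\kappa)A_j,$$ where $s_0=1$ and $s_j(z_1,\dots,z_\kappa)=\sum_{1\le i_1<\dots<i_j\le\kappa}z_{i_1}\cdots z_{i_j}$ is the $j$-th elementary symmetric polynomial. *)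

theory Defs
  imports "HOL-Analysis.Analysis" "HOL-Computational_Algebra.Polynomial"
begin

text \<open>
  Matrix polynomials in one variable are elements of \<^typ>\<open>(complex^'n^'n) poly\<close>. The type
  \<^typ>\<open>complex^'n^'n\<close> carries the entrywise product of \<^class>\<open>times\<close>, not the matrix product, and
  no scalar action of the complex numbers, so \<^const>\<open>poly\<close> is not used for evaluation.
\<close>

definition mat_smult :: "complex \<Rightarrow> complex^'n^'m \<Rightarrow> complex^'n^'m" where
  "mat_smult c A = map_matrix (\<lambda>a. c * a) A"

definition matpoly_eval :: "(complex^'n^'n) poly \<Rightarrow> complex \<Rightarrow> complex^'n^'n" where
  "matpoly_eval P z = (\<Sum>j\<le>degree P. mat_smult (z ^ j) (coeff P j))"

text \<open>The value \<open>y\<^sup>* v\<close>.\<close>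

definition herm_prod :: "complex^'n \<Rightarrow> complex^'n \<Rightarrow> complex" where
  "herm_prod y v = (\<Sum>i\<in>UNIV. cnj (y $ i) * v $ i)"

text \<open>
  A matrix polynomial enters only through its values, so \<open>R\<close> is its evaluation map and \<open>E\<close> a
  set of evaluation points: \<open>E = D\<close> for one variable, and \<open>E = poly_domain \<kappa> D\<close> for
  \<open>\<kappa>\<close> variables. The vector \<open>y\<close> may depend on \<open>x\<close> but not on the point.
\<close>

definition hyperstable :: "('p \<Rightarrow> complex^'n^'n) \<Rightarrow> 'p set \<Rightarrow> bool" where
  "hyperstable R E \<longleftrightarrow>
     (\<forall>x. x \<noteq> 0 \<longrightarrow> (\<exists>y. y \<noteq> 0 \<and> (\<forall>\<mu>\<in>E. herm_prod y (R \<mu> *v x) \<noteq> 0)))"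

definition poly_domain :: "nat \<Rightarrow> complex set \<Rightarrow> (nat \<Rightarrow> complex) set" where
  "poly_domain \<kappa> D = {1..\<kappa>} \<rightarrow>\<^sub>E D"

definition elem_sym :: "nat \<Rightarrow> nat \<Rightarrow> (nat \<Rightarrow> complex) \<Rightarrow> complex" where
  "elem_sym \<kappa> j z = (\<Sum>I | I \<subseteq> {1..\<kappa>} \<and> card I = j. \<Prod>i\<in>I. z i)"

text \<open>
  The convention \<open>A\<^sub>j = 0\<close> for \<open>j\<close> above the degree is built into \<^const>\<open>coeff\<close>.
\<close>

definition polarization :: "nat \<Rightarrow> (complex^'n^'n) poly \<Rightarrow> (nat \<Rightarrow> complex) \<Rightarrow> complex^'n^'n" where
  "polarization \<kappa> P z =
     (\<Sum>j=0..\<kappa>. mat_smult (inverse (of_nat (\<kappa> choose j)) * elem_sym \<kappa> j z) (coeff P j))"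

text \<open>
  Discs have positive radius. On the complex numbers \<open>a \<bullet> z = Re (cnj a * z)\<close>, so the last two
  sets are arbitrary half-planes.
\<close>

definition disc_or_half_plane :: "complex set \<Rightarrow> bool" where
  "disc_or_half_plane D \<longleftrightarrow>
     (\<exists>c r. r > 0 \<and> (D = ball c r \<or> D = cball c r)) \<or>
     (\<exists>a b. a \<noteq> 0 \<and> (D = {z. a \<bullet> z < b} \<or> D = {z. a \<bullet> z \<le> b}))"

end

theory Submission
  imports Defs "HOL-Computational_Algebra.Fundamental_Theorem_Algebra"
begin

text \<open>
  For fixed \<open>x\<close> and \<open>y\<close>, the map \<open>\<mu> \<mapsto> y\<^sup>* P(\<mu>) x\<close> is a scalar polynomial and polarization commutes with
  \<open>y\<^sup>* \<cdot> x\<close>, so a vector \<open>y\<close> that works for \<open>P\<close> also works for its polarization by the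
  Grace-Walsh-Szego theorem; conversely, \<open>P\<close> is the restriction of its polarization to the diagonal.

  Grace-Walsh-Szego follows by polarizing one variable at a time: fixing one variable of the polarization
  of a scalar \<open>p\<close> at \<open>\<zeta> \<in> D\<close> yields, up to the factor \<open>n\<close>, the polarization of the polar derivative
  \<open>n p + (\<zeta> - X) p'\<close>. With \<open>r\<close> ranging over the roots of \<open>p\<close>, the quotient of the polar derivative by
  \<open>p(l)\<close> is a sum of the \<open>(\<zeta> - r) / (l - r)\<close> and copies of \<open>1\<close> (roots at infinity). The
  former lie in an open half-plane bounded by a line through the origin, and \<open>1\<close> in its closure.
\<close>

section \<open>Circular regions and their Hermitian forms\<close>

text \<open>With \<alpha> \<ge> 0, sublevel sets of this one form cover discs (\<alpha> > 0) and
  half-planes (\<alpha> = 0) at once.\<close>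

definition circ_form :: "real \<Rightarrow> complex \<Rightarrow> real \<Rightarrow> complex \<Rightarrow> real" where
  "circ_form \<alpha> \<beta> \<gamma> z = \<alpha> * (cmod z)\<^sup>2 + Re (\<beta> * z) + \<gamma>"

text \<open>
  The Hermitian polarization of \<^const>\<open>circ_form\<close>. Multiplication by \<open>circ_sesq \<alpha> \<beta> \<gamma> z l\<close> moves the
  quotients \<open>(z - r) / (l - r)\<close> with \<open>z\<close>, \<open>l\<close> inside and \<open>r\<close> outside the region into \<open>Re < 0\<close>.
\<close>

definition circ_sesq :: "real \<Rightarrow> complex \<Rightarrow> real \<Rightarrow> complex \<Rightarrow> complex \<Rightarrow> complex" where
  "circ_sesq \<alpha> \<beta> \<gamma> z l = of_real \<alpha> * cnj z * l + (\<beta> * l + cnj (\<beta> * z)) / 2 + of_real \<gamma>"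

text \<open>Expand the Hermitian form at (l, 1) - (z, 1) = (l - z, 0). This handles roots at
  infinity, whose quotient is 1.\<close>

lemma two_Re_circ_sesq:
  "2 * Re (circ_sesq \<alpha> \<beta> \<gamma> z l) =
     circ_form \<alpha> \<beta> \<gamma> l + circ_form \<alpha> \<beta> \<gamma> z - \<alpha> * (cmod (z - l))\<^sup>2"
  unfolding circ_form_def circ_sesq_def cmod_power2
  by (simp add: field_simps power2_eq_square)

text \<open>Expand the Hermitian form at both sides of (z - l) (r, 1) = (z - r) (l, 1) - (l - r) (z,
  1).\<close>

lemma two_Re_circ_sesq_cross:
  "2 * Re (circ_sesq \<alpha> \<beta> \<gamma> z l * ((z - r) * cnj (l - r))) =
     (cmod (z - r))\<^sup>2 * circ_form \<alpha> \<beta> \<gamma> l + (cmod (l - r))\<^sup>2 * circ_form \<alpha> \<beta> \<gamma> z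
     - (cmod (z - l))\<^sup>2 * circ_form \<alpha> \<beta> \<gamma> r"
  unfolding circ_form_def circ_sesq_def cmod_power2
  by (simp add: field_simps power2_eq_square)

text \<open>In the cross identity no term on the right is positive, and the strict gap between z and
  r makes one of the last two negative. The bounds on z and r fit open regions (q(z) < 0 \<le> q(r))
  as well as closed ones (q(z) \<le> 0 < q(r)).\<close>

lemma Re_circ_sesq_quotient_neg:
  assumes l: "circ_form \<alpha> \<beta> \<gamma> l \<le> 0" and z: "circ_form \<alpha> \<beta> \<gamma> z \<le> 0"
    and r: "circ_form \<alpha> \<beta> \<gamma> r \<ge> 0" "circ_form \<alpha> \<beta> \<gamma> z < circ_form \<alpha> \<beta> \<gamma> r"
    and "l \<noteq> r" "z \<noteq> l"
  shows "Re (circ_sesq \<alpha> \<beta> \<gamma> z l * ((z - r) / (l - r))) < 0"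
proof -
  let ?q = "circ_form \<alpha> \<beta> \<gamma>"
  have lr: "(cmod (l - r))\<^sup>2 > 0" and zl: "(cmod (z - l))\<^sup>2 > 0"
    using assms by auto
  have 1: "(cmod (z - r))\<^sup>2 * ?q l \<le> 0"
    using l by (simp add: mult_nonneg_nonpos)
  have 2: "(cmod (l - r))\<^sup>2 * ?q z \<le> 0" "(cmod (z - l))\<^sup>2 * ?q r \<ge> 0"
    using z r by (simp_all add: mult_nonneg_nonpos)
  have "(cmod (l - r))\<^sup>2 * ?q z < 0 \<or> (cmod (z - l))\<^sup>2 * ?q r > 0"
    using r(2) lr zl by (cases "?q r > 0") (simp_all add: mult_pos_neg)
  with 1 2 have "2 * Re (circ_sesq \<alpha> \<beta> \<gamma> z l * ((z - r) * cnj (l - r))) < 0"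
    unfolding two_Re_circ_sesq_cross by linarith
  moreover have "circ_sesq \<alpha> \<beta> \<gamma> z l * ((z - r) / (l - r)) =
      circ_sesq \<alpha> \<beta> \<gamma> z l * ((z - r) * cnj (l - r)) / of_real ((cmod (l - r))\<^sup>2)"
    by (subst complex_div_cnj) (simp add: algebra_simps)
  ultimately show ?thesis
    using lr by (simp add: Re_divide_of_real divide_neg_pos del: of_real_power)
qed

text \<open>Since 1 + (z - l) / (l - r) = (z - r) / (l - r), the bracket is the sum of these
  quotients over all roots with multiplicity. The induction splits off one root at a time.\<close>

lemma Re_circ_sesq_logderiv:
  fixes p :: "complex poly"
  assumes l: "circ_form \<alpha> \<beta> \<gamma> l \<le> 0" and z: "circ_form \<alpha> \<beta> \<gamma> z \<le> 0" and "z \<noteq> l"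
    and r: "\<And>r. poly p r = 0 \<Longrightarrow> circ_form \<alpha> \<beta> \<gamma> r \<ge> 0 \<and> circ_form \<alpha> \<beta> \<gamma> z < circ_form \<alpha> \<beta> \<gamma> r"
    and "poly p l \<noteq> 0" "degree p > 0"
  shows "Re (circ_sesq \<alpha> \<beta> \<gamma> z l * (of_nat (degree p) + (z - l) * poly (pderiv p) l / poly p l)) < 0"
  using r assms(5,6)
proof (induction "degree p" arbitrary: p rule: less_induct)
  case less
  let ?Q = "circ_sesq \<alpha> \<beta> \<gamma> z l"
  from less.prems have "\<not> constant (poly p)"
    by (simp add: constant_degree)
  then obtain r where pr: "poly p r = 0"
    using fundamental_theorem_of_algebra by blast
  then obtain s where p: "p = [:- r, 1:] * s"
    by (metis dvdE poly_eq_0_iff_dvd)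
  have ps: "poly p x = (x - r) * poly s x" for x
    unfolding p by (simp add: algebra_simps)
  have nz: "l \<noteq> r" "poly s l \<noteq> 0"
    using less.prems(2) ps by auto
  then have "s \<noteq> 0" by auto
  then have deg: "degree p = Suc (degree s)"
    unfolding p by (subst degree_mult_eq) auto
  have der: "poly (pderiv p) l = poly s l + (l - r) * poly (pderiv s) l"
    unfolding p pderiv_mult by (simp add: pderiv_pCons algebra_simps)
  have "(of_nat (degree p) + (z - l) * poly (pderiv p) l / poly p l) =
     (z - r) / (l - r) + (of_nat (degree s) + (z - l) * poly (pderiv s) l / poly s l)"
    unfolding der ps deg using nz by (simp add: field_simps)
  then have split: "Re (?Q * (of_nat (degree p) + (z - l) * poly (pderiv p) l / poly p l)) =
     Re (?Q * ((z - r) / (l - r))) +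
     Re (?Q * (of_nat (degree s) + (z - l) * poly (pderiv s) l / poly s l))"
    by (simp only: distrib_left plus_complex.sel)
  have neg: "Re (?Q * ((z - r) / (l - r))) < 0"
    using l z less.prems(1)[OF pr] nz \<open>z \<noteq> l\<close> by (intro Re_circ_sesq_quotient_neg) auto
  show ?case
  proof (cases "degree s = 0")
    case True
    then have "pderiv s = 0"
      by (simp add: pderiv_eq_0_iff)
    with True neg split show ?thesis by simp
  next
    case False
    then have "Re (?Q * (of_nat (degree s) + (z - l) * poly (pderiv s) l / poly s l)) < 0"
      using less.prems(1) nz deg by (intro less.hyps) (auto simp: ps)
    with neg split show ?thesis by linarith
  qed
qed

text \<open>Laguerre's theorem on polar derivatives.\<close>

lemma polar_derivative_nonzero:
  fixes p :: "complex poly"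
  assumes D: "D = {z. circ_form \<alpha> \<beta> \<gamma> z < 0} \<or> D = {z. circ_form \<alpha> \<beta> \<gamma> z \<le> 0}" and "\<alpha> \<ge> 0"
    and "degree p \<le> n" "n > 0" and p: "\<And>x. x \<in> D \<Longrightarrow> poly p x \<noteq> 0" and "z \<in> D" "l \<in> D"
  shows "of_nat n * poly p l + (z - l) * poly (pderiv p) l \<noteq> 0"
proof (cases "z = l \<or> degree p = 0")
  case True
  then have "(z - l) * poly (pderiv p) l = 0"
    using pderiv_eq_0_iff[of p] by auto
  then show ?thesis
    using p[OF \<open>l \<in> D\<close>] \<open>n > 0\<close> by (simp only: add_0_right) simp
next
  case False
  let ?q = "circ_form \<alpha> \<beta> \<gamma>" and ?Q = "circ_sesq \<alpha> \<beta> \<gamma> z l"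
  let ?w = "of_nat (degree p) + (z - l) * poly (pderiv p) l / poly p l"
  have q: "?q l \<le> 0" "?q z \<le> 0"
    using D \<open>z \<in> D\<close> \<open>l \<in> D\<close> by auto
  have root: "?q r \<ge> 0 \<and> ?q z < ?q r" if "poly p r = 0" for r
    using p[of r] that D \<open>z \<in> D\<close> by (force simp: not_less not_le)
  have neg: "Re (?Q * ?w) < 0"
    using False q root p[OF \<open>l \<in> D\<close>] by (intro Re_circ_sesq_logderiv) auto
  \<comment> \<open>Here \<alpha> \<ge> 0 enters: it keeps the quotient 1 of a root at infinity in
    the closed half-plane.\<close>
  have "Re ?Q \<le> 0"
    using two_Re_circ_sesq[of \<alpha> \<beta> \<gamma> z l] q mult_nonneg_nonneg[OF \<open>\<alpha> \<ge> 0\<close>, of "(cmod (z - l))\<^sup>2"]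
    by simp
  then have nonpos: "Re (?Q * of_nat (n - degree p)) \<le> 0"
    by (simp add: mult_nonpos_nonneg)
  \<comment> \<open>Relative to n, the polynomial has n - \<open>degree p\<close> roots at infinity,
    each contributing 1.\<close>
  have "of_nat n * poly p l + (z - l) * poly (pderiv p) l =
      poly p l * (of_nat (n - degree p) + ?w)"
    using p[OF \<open>l \<in> D\<close>] \<open>degree p \<le> n\<close> by (simp add: field_simps of_nat_diff)
  moreover have "of_nat (n - degree p) + ?w \<noteq> 0"
  proof
    assume "of_nat (n - degree p) + ?w = 0"
    then have "Re (?Q * of_nat (n - degree p) + ?Q * ?w) = 0"
      by (metis distrib_left mult_zero_right zero_complex.sel(1))
    with neg nonpos show False
      unfolding plus_complex.sel by linarith
  qed
  ultimately show ?thesis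
    using p[OF \<open>l \<in> D\<close>] by simp
qed

section \<open>Elementary symmetric polynomials\<close>

lemma elem_sym_0: "elem_sym n 0 z = 1"
proof -
  have "{I. I \<subseteq> {1..n} \<and> card I = 0} = {{}}"
    by (auto dest: finite_subset)
  then show ?thesis by (simp add: elem_sym_def)
qed

lemma elem_sym_eq_0:
  assumes "n < j"
  shows "elem_sym n j z = 0"
proof -
  have "card I \<le> n" if "I \<subseteq> {1..n}" for I
    using card_mono[OF _ that] by simp
  then have "{I. I \<subseteq> {1..n} \<and> card I = j} = {}"
    using assms by (metis (mono_tags, lifting) Collect_empty_eq not_le)
  then show ?thesis unfolding elem_sym_def by (simp only: sum.empty)
qed

text \<open>Index sets are sorted by whether they contain \<open>Suc n\<close>.\<close>

lemma elem_sym_Suc_Suc: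
  "elem_sym (Suc n) (Suc j) z = elem_sym n (Suc j) z + z (Suc n) * elem_sym n j z"
proof -
  let ?A = "{I. I \<subseteq> {1..n} \<and> card I = Suc j}" and ?B = "{I. I \<subseteq> {1..n} \<and> card I = j}"
  have fin: "finite I" "Suc n \<notin> I" if "I \<subseteq> {1..n}" for I
    using that finite_subset by auto
  have Suc_n: "{1..Suc n} = insert (Suc n) {1..n}"
    by (simp add: atLeastAtMostSuc_conv)
  have split: "{I. I \<subseteq> {1..Suc n} \<and> card I = Suc j} = ?A \<union> insert (Suc n) ` ?B"
  proof (intro equalityI subsetI)
    fix I assume "I \<in> {I. I \<subseteq> {1..Suc n} \<and> card I = Suc j}"
    then have I: "I \<subseteq> insert (Suc n) {1..n}" "card I = Suc j"
      unfolding Suc_n by simp_all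
    show "I \<in> ?A \<union> insert (Suc n) ` ?B"
    proof (cases "Suc n \<in> I")
      case True
      then have "I - {Suc n} \<subseteq> {1..n}" "card (I - {Suc n}) = j" "I = insert (Suc n) (I - {Suc n})"
        using I by (blast, simp, blast)
      then show ?thesis by blast
    next
      case False
      then show ?thesis using I by blast
    qed
  next
    fix I assume "I \<in> ?A \<union> insert (Suc n) ` ?B"
    then consider "I \<subseteq> {1..n}" "card I = Suc j"
      | K where "K \<subseteq> {1..n}" "card K = j" "I = insert (Suc n) K" by blast
    then show "I \<in> {I. I \<subseteq> {1..Suc n} \<and> card I = Suc j}"
      unfolding Suc_n by cases (blast, use fin in \<open>simp add: subset_insertI2 insert_mono\<close>)
  qed
  have inj: "inj_on (insert (Suc n)) ?B"
    using fin(2) by (intro inj_onI) (metis (lifting) insert_ident mem_Collect_eq)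
  have "elem_sym (Suc n) (Suc j) z =
      (\<Sum>I\<in>?A. \<Prod>i\<in>I. z i) + (\<Sum>I\<in>insert (Suc n) ` ?B. \<Prod>i\<in>I. z i)"
    unfolding elem_sym_def split
    by (rule sum.union_disjoint) (use fin(2) in auto)
  also have "(\<Sum>I\<in>insert (Suc n) ` ?B. \<Prod>i\<in>I. z i) = (\<Sum>I\<in>?B. z (Suc n) * (\<Prod>i\<in>I. z i))"
    unfolding sum.reindex[OF inj] using fin by (intro sum.cong) auto
  finally show ?thesis
    by (simp add: elem_sym_def sum_distrib_left)
qed

lemma elem_sym_const:
  assumes "\<And>i. i \<in> {1..n} \<Longrightarrow> z i = c"
  shows "elem_sym n j z = of_nat (n choose j) * c ^ j"
proof -
  have "elem_sym n j z = (\<Sum>I | I \<subseteq> {1..n} \<and> card I = j. c ^ j)"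
    unfolding elem_sym_def
  proof (intro sum.cong refl)
    fix I assume I: "I \<in> {I. I \<subseteq> {1..n} \<and> card I = j}"
    then have "(\<Prod>i\<in>I. z i) = (\<Prod>i\<in>I. c)"
      using assms by (intro prod.cong) auto
    with I show "(\<Prod>i\<in>I. z i) = c ^ j" by simp
  qed
  then show ?thesis
    using n_subsets[of "{1..n}" j] by simp
qed

section \<open>Polarization of scalar polynomials\<close>

definition poly_polarization :: "nat \<Rightarrow> complex poly \<Rightarrow> (nat \<Rightarrow> complex) \<Rightarrow> complex" where
  "poly_polarization n p z =
     (\<Sum>j\<le>n. inverse (of_nat (n choose j)) * elem_sym n j z * coeff p j)"

text \<open>The recursion for \<open>elem_sym\<close> separates the terms with and without
  \<open>z (Suc n)\<close>; the absorption identities for binomials (\<open>low\<close>,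
  \<open>up\<close>) match the weights of the two kinds.\<close>

lemma poly_polarization_polar_derivative:
  "poly_polarization n (smult (of_nat (Suc n)) p + [:z (Suc n), -1:] * pderiv p) z =
     of_nat (Suc n) * poly_polarization (Suc n) p z"
proof -
  let ?e = "\<lambda>j. elem_sym n j z" and ?c = "\<lambda>j. complex_of_nat (n choose j)" and ?s = "z (Suc n)"
  have coeff: "coeff (smult (of_nat (Suc n)) p + [:?s, -1:] * pderiv p) j =
      (of_nat (Suc n) - of_nat j) * coeff p j + ?s * of_nat (Suc j) * coeff p (Suc j)" for j
    by (cases j) (simp_all add: coeff_pderiv algebra_simps)
  have frac: "inverse c * a = b * inverse d" if "a * d = b * c" "c \<noteq> 0" "d \<noteq> 0" for a b c d :: complex
    using that by (simp add: field_simps)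
  have low: "inverse (?c j) * (of_nat (Suc n) - of_nat j) =
      of_nat (Suc n) * inverse (of_nat (Suc n choose j))" if "j \<le> n" for j
  proof (rule frac)
    have "(Suc n - j) * (Suc n choose j) = Suc n * (n choose j)"
      using binomial_absorb_comp[of "Suc n" j] by simp
    then have "complex_of_nat ((Suc n - j) * (Suc n choose j)) = of_nat (Suc n * (n choose j))"
      by (simp only:)
    with that show "(of_nat (Suc n) - of_nat j) * of_nat (Suc n choose j) = of_nat (Suc n) * ?c j"
      by (simp only: of_nat_mult of_nat_diff le_SucI)
  qed (use that in \<open>simp_all del: binomial_Suc_Suc\<close>)
  have up: "inverse (?c j) * of_nat (Suc j) =
      of_nat (Suc n) * inverse (of_nat (Suc n choose Suc j))" if "j \<le> n" for j
  proof (rule frac)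
    have "complex_of_nat (Suc j * (Suc n choose Suc j)) = of_nat (Suc n * (n choose j))"
      by (simp only: Suc_times_binomial_eq mult.commute)
    then show "of_nat (Suc j) * of_nat (Suc n choose Suc j) = of_nat (Suc n) * ?c j"
      by (simp only: of_nat_mult)
  qed (use that in \<open>simp_all del: binomial_Suc_Suc\<close>)
  have "poly_polarization n (smult (of_nat (Suc n)) p + [:?s, -1:] * pderiv p) z =
      (\<Sum>j\<le>n. (inverse (?c j) * (of_nat (Suc n) - of_nat j)) * (?e j * coeff p j) +
              (inverse (?c j) * of_nat (Suc j)) * (?s * ?e j * coeff p (Suc j)))"
    unfolding poly_polarization_def coeff
    by (intro sum.cong refl) (simp only: distrib_left mult.assoc mult.left_commute)
  also have "\<dots> = of_nat (Suc n) * (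
      (\<Sum>j\<le>n. inverse (of_nat (Suc n choose j)) * ?e j * coeff p j) +
      (\<Sum>j\<le>n. inverse (of_nat (Suc n choose Suc j)) * (?s * ?e j) * coeff p (Suc j)))"
    unfolding sum_distrib_left distrib_left sum.distrib[symmetric]
    by (intro sum.cong refl arg_cong2[where f = "(+)"]) (simp_all only: atMost_iff low up mult.assoc)
  \<comment> \<open>The added summand vanishes, because n variables have no elementary symmetric
    polynomial of degree n + 1.\<close>
  also have "(\<Sum>j\<le>n. inverse (of_nat (Suc n choose j)) * ?e j * coeff p j) =
      (\<Sum>j\<le>Suc n. inverse (of_nat (Suc n choose j)) * ?e j * coeff p j)"
    by (simp add: elem_sym_eq_0 del: binomial_Suc_Suc)
  also have "\<dots> = coeff p 0 + (\<Sum>j\<le>n. inverse (of_nat (Suc n choose Suc j)) * ?e (Suc j) * coeff p (Suc j))"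
    by (subst sum.atMost_Suc_shift) (simp add: elem_sym_0 del: binomial_Suc_Suc)
  also have "\<dots> + (\<Sum>j\<le>n. inverse (of_nat (Suc n choose Suc j)) * (?s * ?e j) * coeff p (Suc j)) =
      coeff p 0 + (\<Sum>j\<le>n. inverse (of_nat (Suc n choose Suc j)) * (?e (Suc j) + ?s * ?e j) * coeff p (Suc j))"
    by (simp only: add.assoc sum.distrib distrib_left distrib_right)
  also have "\<dots> = poly_polarization (Suc n) p z"
    unfolding poly_polarization_def sum.atMost_Suc_shift elem_sym_Suc_Suc
    by (simp add: elem_sym_0 del: binomial_Suc_Suc)
  finally show ?thesis .
qed

text \<open>The Grace-Walsh-Szego coincidence theorem.\<close>

lemma poly_polarization_nonzero:
  assumes D: "D = {z. circ_form \<alpha> \<beta> \<gamma> z < 0} \<or> D = {z. circ_form \<alpha> \<beta> \<gamma> z \<le> 0}" and "\<alpha> \<ge> 0"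
    and "D \<noteq> {}" "degree p \<le> n" "\<And>x. x \<in> D \<Longrightarrow> poly p x \<noteq> 0" "\<And>i. i \<in> {1..n} \<Longrightarrow> z i \<in> D"
  shows "poly_polarization n p z \<noteq> 0"
  using assms(4-6)
proof (induction n arbitrary: p)
  case 0
  then obtain c where "p = [:c:]"
    by (auto elim: degree_eq_zeroE)
  then show ?case
    using 0 \<open>D \<noteq> {}\<close> by (auto simp: poly_polarization_def elem_sym_0)
next
  case (Suc n)
  let ?p = "smult (of_nat (Suc n)) p + [:z (Suc n), -1:] * pderiv p"
  \<comment> \<open>In degree n + 1 the contributions of (n + 1) p and - X p' cancel.\<close>
  have "degree ?p \<le> n"
  proof (rule degree_le, intro allI impI)
    fix i assume "n < i"
    then obtain k where k: "i = Suc k" "n \<le> k" by (cases i) auto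
    then have "coeff p (Suc (Suc k)) = 0" "k \<noteq> n \<Longrightarrow> coeff p (Suc k) = 0"
      using Suc.prems(1) by (auto intro!: coeff_eq_0)
    then show "coeff ?p i = 0"
      unfolding k by (cases "k = n") (auto simp: coeff_pderiv)
  qed
  moreover have "poly ?p x \<noteq> 0" if "x \<in> D" for x
    using polar_derivative_nonzero[OF D \<open>\<alpha> \<ge> 0\<close> Suc.prems(1) _ Suc.prems(2), of "z (Suc n)" x]
      that Suc.prems(3)
    by (simp add: algebra_simps)
  ultimately have "poly_polarization n ?p z \<noteq> 0"
    using Suc.prems(3) by (intro Suc.IH) auto
  then show ?case
    unfolding poly_polarization_polar_derivative by simp
qed

section \<open>Discs and half-planes as circular regions\<close>

lemma disc_or_half_plane_circ_form:
  assumes "disc_or_half_plane D"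
  obtains \<alpha> \<beta> \<gamma> where "\<alpha> \<ge> 0"
    "D = {z. circ_form \<alpha> \<beta> \<gamma> z < 0} \<or> D = {z. circ_form \<alpha> \<beta> \<gamma> z \<le> 0}"
proof -
  from assms consider
      c r where "r > 0" "D = ball c r \<or> D = cball c r"
    | a b where "D = {z. a \<bullet> z < b} \<or> D = {z. a \<bullet> z \<le> b}"
    unfolding disc_or_half_plane_def by metis
  then show ?thesis
  proof cases
    case 1
    \<comment> \<open>The coefficients come from expanding |z - c|^2 - r^2.\<close>
    have form: "circ_form 1 (- (2 * cnj c)) ((cmod c)\<^sup>2 - r\<^sup>2) z = (dist c z)\<^sup>2 - r\<^sup>2" for z
      unfolding circ_form_def dist_norm cmod_power2 by (simp add: power2_eq_square algebra_simps)
    have "(dist c z)\<^sup>2 < r\<^sup>2 \<longleftrightarrow> dist c z < r" "(dist c z)\<^sup>2 \<le> r\<^sup>2 \<longleftrightarrow> dist c z \<le> r" for z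
      using \<open>r > 0\<close> power_mono_iff[of "dist c z" r 2] power_mono_iff[of r "dist c z" 2]
      by (auto simp flip: not_le)
    then show ?thesis
      using 1(2) by (intro that[of 1 "- (2 * cnj c)" "(cmod c)\<^sup>2 - r\<^sup>2"]) (auto simp: form)
  next
    case 2
    have "circ_form 0 (cnj a) (- b) z = a \<bullet> z - b" for z
      by (simp add: circ_form_def inner_complex_def)
    then show ?thesis
      using 2 by (intro that[of 0 "cnj a" "- b"]) auto
  qed
qed

lemma disc_or_half_plane_nonempty:
  assumes "disc_or_half_plane D"
  shows "D \<noteq> {}"
proof -
  \<comment> \<open>The witness is the multiple of a whose inner product with a is b - 1.\<close>
  have "\<exists>z. a \<bullet> z < b" if "a \<noteq> 0" for a :: complex and b
    using that by (intro exI[of _ "((b - 1) / (a \<bullet> a)) *\<^sub>R a"]) simp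
  then show ?thesis
    using assms less_imp_le unfolding disc_or_half_plane_def
    by (elim disjE exE conjE) (force | blast)+
qed

section \<open>Reduction of matrix polynomials to scalar ones\<close>

lemma herm_prod_sum_mat_smult:
  "herm_prod y ((\<Sum>j\<in>J. mat_smult (c j) (A j)) *v x) = (\<Sum>j\<in>J. c j * herm_prod y (A j *v x))"
proof (induction J rule: infinite_finite_induct)
  case (insert j J)
  have "herm_prod y ((mat_smult d B + C) *v x) = d * herm_prod y (B *v x) + herm_prod y (C *v x)"
    for B C d
    by (simp add: herm_prod_def matrix_vector_mult_def mat_smult_def map_matrix_def
        sum.distrib sum_distrib_left algebra_simps)
  with insert show ?case by simp
qed (simp_all add: herm_prod_def)

theorem theorem6p2:
  fixes \<kappa> :: nat and D :: "complex set" and P :: "(complex^'n^'n) poly"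
  assumes "\<kappa> \<ge> 1"
    and "disc_or_half_plane D"
    and "degree P \<le> \<kappa>"
  shows "hyperstable (matpoly_eval P) D \<longleftrightarrow> hyperstable (polarization \<kappa> P) (poly_domain \<kappa> D)"
proof
  assume stable: "hyperstable (matpoly_eval P) D"
  obtain \<alpha> \<beta> \<gamma> where form: "\<alpha> \<ge> 0"
    "D = {z. circ_form \<alpha> \<beta> \<gamma> z < 0} \<or> D = {z. circ_form \<alpha> \<beta> \<gamma> z \<le> 0}"
    using assms(2) by (rule disc_or_half_plane_circ_form)
  show "hyperstable (polarization \<kappa> P) (poly_domain \<kappa> D)"
    unfolding hyperstable_def
  proof (intro allI impI)
    fix x :: "complex^'n" assume "x \<noteq> 0"
    with stable obtain y where y: "y \<noteq> 0" "\<And>\<mu>. \<mu> \<in> D \<Longrightarrow> herm_prod y (matpoly_eval P \<mu> *v x) \<noteq> 0"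
      unfolding hyperstable_def by blast
    \<comment> \<open>This is the scalar polynomial y* P x. Its degree may be below that of P, so
      only an upper bound on it is derived.\<close>
    define p where "p = (\<Sum>j\<le>degree P. monom (herm_prod y (coeff P j *v x)) j)"
    have coeff_p: "coeff p j = herm_prod y (coeff P j *v x)" for j
      by (auto simp: p_def coeff_sum coeff_eq_0 herm_prod_def if_distrib cong: if_cong)
    have deg: "degree p \<le> degree P"
      by (rule degree_le) (simp add: coeff_p coeff_eq_0 herm_prod_def)
    have "poly p \<mu> = herm_prod y (matpoly_eval P \<mu> *v x)" for \<mu>
      unfolding matpoly_eval_def herm_prod_sum_mat_smult p_def
      by (simp add: poly_sum poly_monom mult.commute)
    then have nz: "poly p \<mu> \<noteq> 0" if "\<mu> \<in> D" for \<mu>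
      using y(2) that by simp
    have "herm_prod y (polarization \<kappa> P z *v x) = poly_polarization \<kappa> p z" for z
      unfolding polarization_def herm_prod_sum_mat_smult poly_polarization_def coeff_p atLeast0AtMost ..
    moreover have "poly_polarization \<kappa> p z \<noteq> 0" if "z \<in> poly_domain \<kappa> D" for z
    proof (rule poly_polarization_nonzero[OF form(2,1) disc_or_half_plane_nonempty[OF assms(2)] _ nz])
      show "degree p \<le> \<kappa>" using deg assms(3) by simp
      show "z i \<in> D" if "i \<in> {1..\<kappa>}" for i
        using that \<open>z \<in> poly_domain \<kappa> D\<close> unfolding poly_domain_def by (rule PiE_mem[rotated])
    qed
    ultimately have "herm_prod y (polarization \<kappa> P z *v x) \<noteq> 0" if "z \<in> poly_domain \<kappa> D" for z
      using that by simp
    with y(1) show "\<exists>y. y \<noteq> 0 \<and> (\<forall>z\<in>poly_domain \<kappa> D. herm_prod y (polarization \<kappa> P z *v x) \<noteq> 0)"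
      by blast
  qed
next
  assume stable: "hyperstable (polarization \<kappa> P) (poly_domain \<kappa> D)"
  \<comment> \<open>The diagonal point is restricted to the index set because
    \<open>poly_domain\<close> consists of extensional functions. The vector y found for the
    polarization then serves for P too.\<close>
  let ?diag = "\<lambda>\<mu>. \<lambda>i\<in>{1..\<kappa>}. \<mu>"
  have "polarization \<kappa> P (?diag \<mu>) = matpoly_eval P \<mu>" for \<mu>
  proof -
    have "inverse (of_nat (\<kappa> choose j)) * elem_sym \<kappa> j (?diag \<mu>) = \<mu> ^ j" if "j \<le> \<kappa>" for j
      using that by (subst elem_sym_const[where c = \<mu>]) auto
    then have "polarization \<kappa> P (?diag \<mu>) = (\<Sum>j\<le>\<kappa>. mat_smult (\<mu> ^ j) (coeff P j))"
      unfolding polarization_def atLeast0AtMost by (intro sum.cong) auto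
    \<comment> \<open>The summands between \<open>degree P\<close> and \<kappa> have zero
      coefficients.\<close>
    also have "\<dots> = matpoly_eval P \<mu>"
      unfolding matpoly_eval_def using assms(3)
      by (intro sum.mono_neutral_right)
        (auto simp: coeff_eq_0 mat_smult_def map_matrix_def vec_eq_iff)
    finally show ?thesis .
  qed
  moreover have "?diag \<mu> \<in> poly_domain \<kappa> D" if "\<mu> \<in> D" for \<mu>
    using that by (auto simp: poly_domain_def)
  ultimately show "hyperstable (matpoly_eval P) D"
    using stable unfolding hyperstable_def by metis
qed

end
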